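(* Let $V\subset\mathcal{A}(\mathbb{C})$ be a quasi-Banach space such that the inclusion $V\hookrightarrow\mathcal{A}(\mathbb{C})$ is continuous. Assume that $V$ contains a nonconstant entire function. If a holomorphic map $f\colon\mathbb{C}\to\mathbb{C}$ induces a bounded linear composition operator $C_f$ on $V$, then $f(z)=az+b$ for some $a,b\in\mathbb{C}$. In addition, $|a|\le 1$ if $V$ is infinite-dimensional.
   Context: $\mathcal{A}(\mathbb{C})$ is the space of entire functions on $\mathbb{C}$ with the topology of uniform convergence on compact sets. A quasi-Banach space is a complete Hausdorff complex topological vector space with a bounded neighborhood of $0$ (equivalently, complete with respect to a quasi-norm); here $V$ is a linear subspace of $\mathcal{A}(\mathbb{C})$ carrying its own quasi-Banach topology. The composition operator is $C_f h:=h\circ f$; "$f$ induces a bounded linear operator $C_f$ on $V$" means that $h\circ f\in V$ for all $h\in V$ and $C_f\colon V\to V$ is bounded (continuous). *)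

theory Defs
  imports "HOL-Complex_Analysis.Complex_Analysis" "HOL-Library.Function_Algebras"
begin

definition cscale :: "complex \<Rightarrow> (complex \<Rightarrow> complex) \<Rightarrow> complex \<Rightarrow> complex" where
  "cscale c h = (\<lambda>z. c * h z)"

global_interpretation cfun: vector_space cscale
  by unfold_locales (auto simp: cscale_def fun_eq_iff algebra_simps)

definition infinite_dimensional :: "(complex \<Rightarrow> complex) set \<Rightarrow> bool" where
  "infinite_dimensional V \<longleftrightarrow> \<not> (\<exists>B. finite B \<and> B \<subseteq> V \<and> cfun.span B = V)"

definition entire_functions :: "(complex \<Rightarrow> complex) set" where
  "entire_functions = {h. h holomorphic_on UNIV}"

definition entire_topology :: "(complex \<Rightarrow> complex) topology" where
  "entire_topology = topology (\<lambda>U. U \<subseteq> entire_functions \<and>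
     (\<forall>g\<in>U. \<exists>K e. compact K \<and> e > 0 \<and>
        {h \<in> entire_functions. \<forall>z\<in>K. dist (h z) (g z) < e} \<subseteq> U))"

lemma openin_entire_topology:
  "openin entire_topology U \<longleftrightarrow> U \<subseteq> entire_functions \<and>
     (\<forall>g\<in>U. \<exists>K e. compact K \<and> e > 0 \<and>
        {h \<in> entire_functions. \<forall>z\<in>K. dist (h z) (g z) < e} \<subseteq> U)"
proof -
  define P where "P \<equiv> \<lambda>U. U \<subseteq> entire_functions \<and>
     (\<forall>g\<in>U. \<exists>K e. compact K \<and> e > (0::real) \<and>
        {h \<in> entire_functions. \<forall>z\<in>K. dist (h z) (g z) < e} \<subseteq> U)"
  have "P (S \<inter> U)" if S: "P S" and U: "P U" for S U
    unfolding P_def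
  proof (intro conjI ballI)
    show "S \<inter> U \<subseteq> entire_functions"
      using S by (auto simp: P_def)
    fix g assume g: "g \<in> S \<inter> U"
    from g S obtain K d where K: "compact K" "d > 0"
        "{h \<in> entire_functions. \<forall>z\<in>K. dist (h z) (g z) < d} \<subseteq> S"
      unfolding P_def by blast
    from g U obtain L e where L: "compact L" "e > 0"
        "{h \<in> entire_functions. \<forall>z\<in>L. dist (h z) (g z) < e} \<subseteq> U"
      unfolding P_def by blast
    have "{h \<in> entire_functions. \<forall>z\<in>K \<union> L. dist (h z) (g z) < min d e} \<subseteq> S \<inter> U"
      using K(3) L(3) by auto
    with K L show "\<exists>K e. compact K \<and> e > 0 \<and>
        {h \<in> entire_functions. \<forall>z\<in>K. dist (h z) (g z) < e} \<subseteq> S \<inter> U"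
      by (intro exI[of _ "K \<union> L"] exI[of _ "min d e"]) (auto simp: compact_Un)
  qed
  moreover have "P (\<Union>\<K>)" if \<K>: "\<forall>U\<in>\<K>. P U" for \<K>
    unfolding P_def
  proof (intro conjI ballI)
    show "\<Union>\<K> \<subseteq> entire_functions"
      using \<K> by (auto simp: P_def)
    fix g assume "g \<in> \<Union>\<K>"
    then obtain U where U: "U \<in> \<K>" "g \<in> U"
      by blast
    with \<K> obtain K e where "compact K" "e > 0"
        "{h \<in> entire_functions. \<forall>z\<in>K. dist (h z) (g z) < e} \<subseteq> U"
      unfolding P_def by meson
    with U show "\<exists>K e. compact K \<and> e > 0 \<and>
        {h \<in> entire_functions. \<forall>z\<in>K. dist (h z) (g z) < e} \<subseteq> \<Union>\<K>"
      by (meson Union_upper subset_trans)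
  qed
  ultimately have "istopology P"
    unfolding istopology_def by blast
  then show ?thesis
    unfolding entire_topology_def P_def by (simp add: topology_inverse')
qed

lemma topspace_entire_topology [simp]: "topspace entire_topology = entire_functions"
proof -
  have "openin entire_topology entire_functions"
    unfolding openin_entire_topology by (auto intro!: exI[of _ "{}"] exI[of _ "1::real"])
  moreover have "topspace entire_topology \<subseteq> entire_functions"
    using openin_topspace[of entire_topology] unfolding openin_entire_topology by blast
  ultimately show ?thesis
    using openin_subset by blast
qed

text \<open>
  The elements of \<open>V\<close> are functions, but its topology \<open>T\<close> is an arbitrary one with carrier \<open>V\<close>;
  it need not be inherited from the space of entire functions.
\<close>

definition complex_tvs :: "(complex \<Rightarrow> complex) set \<Rightarrow> (complex \<Rightarrow> complex) topology \<Rightarrow> bool" where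
  "complex_tvs V T \<longleftrightarrow>
     cfun.subspace V \<and> topspace T = V \<and>
     continuous_map (prod_topology T T) T (\<lambda>(g, h). g + h) \<and>
     continuous_map (prod_topology euclidean T) T (\<lambda>(c, h). cscale c h)"

definition tvs_bounded :: "(complex \<Rightarrow> complex) topology \<Rightarrow> (complex \<Rightarrow> complex) set \<Rightarrow> bool" where
  "tvs_bounded T B \<longleftrightarrow> B \<subseteq> topspace T \<and>
     (\<forall>U. openin T U \<and> 0 \<in> U \<longrightarrow>
        (\<exists>s>0. \<forall>c. norm c \<ge> s \<longrightarrow> B \<subseteq> cscale c ` U))"

text \<open>
  Completeness is stated for the translation-invariant uniformity of the topological vector
  space, in terms of Cauchy filters.
\<close>

definition tvs_cauchy_filter ::
  "(complex \<Rightarrow> complex) topology \<Rightarrow> (complex \<Rightarrow> complex) filter \<Rightarrow> bool" where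
  "tvs_cauchy_filter T F \<longleftrightarrow> F \<noteq> bot \<and> F \<le> principal (topspace T) \<and>
     (\<forall>U. openin T U \<and> 0 \<in> U \<longrightarrow> (\<forall>\<^sub>F (g, h) in F \<times>\<^sub>F F. g - h \<in> U))"

definition tvs_complete :: "(complex \<Rightarrow> complex) topology \<Rightarrow> bool" where
  "tvs_complete T \<longleftrightarrow> (\<forall>F. tvs_cauchy_filter T F \<longrightarrow> (\<exists>g. limitin T (\<lambda>h. h) g F))"

definition quasi_banach_space ::
  "(complex \<Rightarrow> complex) set \<Rightarrow> (complex \<Rightarrow> complex) topology \<Rightarrow> bool" where
  "quasi_banach_space V T \<longleftrightarrow>
     complex_tvs V T \<and> Hausdorff_space T \<and> tvs_complete T \<and>
     (\<exists>B. tvs_bounded T B \<and> 0 \<in> T interior_of B)"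

definition composition_operator ::
  "(complex \<Rightarrow> complex) \<Rightarrow> (complex \<Rightarrow> complex) \<Rightarrow> complex \<Rightarrow> complex" where
  "composition_operator f h = h \<circ> f"

definition induces_bounded_composition_operator ::
  "(complex \<Rightarrow> complex) \<Rightarrow> (complex \<Rightarrow> complex) set \<Rightarrow> (complex \<Rightarrow> complex) topology \<Rightarrow> bool" where
  "induces_bounded_composition_operator f V T \<longleftrightarrow>
     (\<forall>h\<in>V. composition_operator f h \<in> V) \<and> continuous_map T T (composition_operator f)"

end

theory Submission
  imports Defs "HOL-Real_Asymp.Real_Asymp"
begin

text \<open>
  If \<open>B\<close> is a bounded neighbourhood of \<open>0\<close>, continuity of \<open>C_f\<close> gives \<open>C_f B \<subseteq> C B\<close> for some \<open>C\<close>,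
  so every \<open>h \<in> V\<close> satisfies \<open>\<bar>h \<circ> f\<^sup>n\<bar> \<le> A C\<^sup>n\<close> on each compact set \<open>K\<close>, where \<open>A\<close> depends on \<open>h\<close>
  and \<open>K\<close> but \<open>C\<close> does not. If \<open>f\<close> is not affine, Cauchy's inequality and Schottky's theorem show
  that the image under \<open>f\<close> of a large disc of radius \<open>R\<close> contains a circle around \<open>0\<close> of radius at
  least \<open>\<delta> R\<^sup>2\<close>. By the maximum principle, \<open>h\<close> is then bounded by \<open>A C\<^sup>n\<close> on discs whose
  radius grows doubly exponentially in \<open>n\<close>, which forces \<open>h\<close> to be constant. If \<open>f z = a z + b\<close> with
  \<open>\<bar>a\<bar> > 1\<close>, then \<open>h\<close> is bounded by \<open>A C\<^sup>n\<close> on the disc of radius \<open>\<bar>a\<bar>\<^sup>n\<close> around the fixed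
  point, so it is a polynomial whose degree is bounded in terms of \<open>C\<close> and \<open>\<bar>a\<bar>\<close>, and \<open>V\<close> is
  finite-dimensional.
\<close>

section \<open>Entire functions\<close>

lemma entire_Cauchy_inequality:
  assumes "h holomorphic_on UNIV" "r > 0" "\<And>z. z \<in> cball p r \<Longrightarrow> norm (h z) \<le> B"
  shows "norm ((deriv ^^ k) h p) \<le> fact k * B / r ^ k"
proof (rule Cauchy_inequality)
  show "h holomorphic_on ball p r" "continuous_on (cball p r) h"
    using assms(1) holomorphic_on_imp_continuous_on holomorphic_on_subset continuous_on_subset
    by blast+
qed (use assms in \<open>auto simp: dist_norm\<close>)

lemma entire_polynomial_if_higher_derivs_zero:
  assumes "h holomorphic_on UNIV" "\<And>k. k > N \<Longrightarrow> (deriv ^^ k) h p = 0"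
  shows "h z = (\<Sum>k\<le>N. (deriv ^^ k) h p / fact k * (z - p) ^ k)"
proof -
  have "(\<lambda>k. (deriv ^^ k) h p / fact k * (z - p) ^ k) sums h z"
  proof (rule holomorphic_power_series)
    show "h holomorphic_on ball p (dist p z + 1)"
      using assms(1) holomorphic_on_subset by blast
  qed auto
  moreover have "(\<lambda>k. (deriv ^^ k) h p / fact k * (z - p) ^ k) sums
      (\<Sum>k\<le>N. (deriv ^^ k) h p / fact k * (z - p) ^ k)"
    by (rule sums_finite) (use assms(2) in auto)
  ultimately show ?thesis
    by (rule sums_unique2)
qed

section \<open>Large circles in the image of an entire function\<close>

text \<open>A weak form of Bohr's theorem. If points \<open>w1\<close>, \<open>w2\<close> of the circles of radius \<open>\<rho>\<close> and \<open>2\<rho>\<close>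
  were omitted, Schottky's theorem would apply to \<open>(g - w1) / (w2 - w1)\<close>.\<close>

lemma entire_image_contains_sphere:
  obtains K :: real where "K \<ge> 1"
    "\<And>g R \<rho> z0. \<lbrakk>g holomorphic_on UNIV; R > 0; \<rho> > 0; norm (g 0) \<le> \<rho>; norm z0 \<le> R / 2;
        norm (g z0) > K * \<rho>\<rbrakk> \<Longrightarrow> \<exists>t\<ge>\<rho>. sphere 0 t \<subseteq> g ` cball (0::complex) R"
proof -
  define S :: real where "S = exp (pi * exp (pi * (2 + 2 * 2 + 12 * (1/2) / (1 - 1/2))))"
  have S: "S > 0" by (simp add: S_def)
  have "\<exists>t\<ge>\<rho>. sphere 0 t \<subseteq> g ` cball (0::complex) R"
    if g: "g holomorphic_on UNIV" and R: "R > 0" and \<rho>: "\<rho> > 0" and g0: "norm (g 0) \<le> \<rho>"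
      and z0: "norm z0 \<le> R / 2" and big: "norm (g z0) > (1 + 3 * S) * \<rho>"
    for g :: "complex \<Rightarrow> complex" and R \<rho> :: real and z0
  proof (rule ccontr)
    assume "\<not> ?thesis"
    then have no: "\<not> sphere 0 \<rho> \<subseteq> g ` cball 0 R" "\<not> sphere 0 (2 * \<rho>) \<subseteq> g ` cball 0 R"
      using \<rho> by force+
    then obtain w1 w2 where w1: "norm w1 = \<rho>" "w1 \<notin> g ` cball 0 R"
      and w2: "norm w2 = 2 * \<rho>" "w2 \<notin> g ` cball 0 R"
      by (auto simp: subset_iff)
    \<comment> \<open>The lower bound on the gap gives \<open>norm (G 0) \<le> 2\<close>; the upper
      bound undoes the normalisation and yields the constant \<open>1 + 3 * S\<close>.\<close>
    have d: "\<rho> \<le> norm (w2 - w1)"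
      using w1(1) w2(1) norm_triangle_ineq2[of w2 w1] by simp
    have d': "norm (w2 - w1) \<le> 3 * \<rho>"
      using w1(1) w2(1) norm_triangle_ineq4[of w2 w1] by simp
    have ne: "w2 - w1 \<noteq> 0" using d \<rho> by auto
    define G where "G = (\<lambda>z. (g (of_real R * z) - w1) / (w2 - w1))"
    have "norm (G (z0 / of_real R)) \<le> S"
      unfolding S_def
    proof (rule Schottky[where f = G and r = 2 and t = "1/2"])
      have "g \<circ> (\<lambda>z. of_real R * z) holomorphic_on cball 0 1"
        by (rule holomorphic_on_compose_gen[where t = UNIV]) (auto intro!: holomorphic_intros g)
      then show "G holomorphic_on cball 0 1"
        unfolding G_def comp_def using ne by (auto intro!: holomorphic_intros)
      have "norm (g 0 - w1) \<le> 2 * \<rho>"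
        using norm_triangle_ineq4[of "g 0" w1] g0 w1 by simp
      also have "\<dots> \<le> 2 * norm (w2 - w1)" using d by simp
      finally show "norm (G 0) \<le> 2"
        using ne by (simp add: G_def norm_divide divide_simps)
      show "\<not> (G z = 0 \<or> G z = 1)" if "z \<in> cball 0 1" for z
      proof -
        have "of_real R * z \<in> cball 0 R"
          using that R by (simp add: norm_mult)
        then have "g (of_real R * z) \<noteq> w1" "g (of_real R * z) \<noteq> w2"
          using w1(2) w2(2) by blast+
        then show ?thesis using ne by (simp add: G_def)
      qed
      show "norm (z0 / of_real R) \<le> 1/2"
        using z0 R by (simp add: norm_divide divide_simps mult.commute)
    qed auto
    moreover have "g z0 = G (z0 / of_real R) * (w2 - w1) + w1"
      using ne R by (simp add: G_def)
    ultimately have "norm (g z0) \<le> S * (3 * \<rho>) + \<rho>"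
      using norm_triangle_ineq[of "G (z0 / of_real R) * (w2 - w1)" w1] w1(1) d' S
        mult_mono[of "norm (G (z0 / of_real R))" S "norm (w2 - w1)" "3 * \<rho>"]
      by (simp add: norm_mult)
    with big show False by (simp add: algebra_simps)
  qed
  then show thesis
    using S by (intro that[of "1 + 3 * S"]) auto
qed

lemma entire_bound_from_sphere:
  assumes "h holomorphic_on UNIV" "\<And>w. w \<in> sphere 0 t \<Longrightarrow> norm (h w) \<le> A" "norm w \<le> t"
  shows "norm (h (w::complex)) \<le> A"
proof (rule maximum_modulus_frontier[where f = h and S = "cball 0 t" and \<xi> = w])
  show "h holomorphic_on interior (cball 0 t)" "continuous_on (closure (cball 0 t)) h"
    using assms(1) holomorphic_on_imp_continuous_on holomorphic_on_subset continuous_on_subset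
    by blast+
qed (use assms in auto)

text \<open>A nonzero Taylor coefficient of order at least 2 forces \<open>f\<close> to be of size
  \<open>R\<^sup>2\<close> somewhere on the disc of radius \<open>R / 2\<close>, so the image of the
  disc of radius \<open>R\<close> contains a circle of that order. The bound on
  \<open>h \<circ> f\<close> holds for \<open>h\<close> on this circle and passes to its
  interior.\<close>

lemma non_affine_growth:
  assumes f: "f holomorphic_on UNIV" and k: "k \<ge> 2" and nz: "(deriv ^^ k) f 0 \<noteq> 0"
  obtains \<delta> R0 :: real where "\<delta> > 0" "R0 > 0"
    "\<And>h R A. \<lbrakk>h holomorphic_on UNIV; R \<ge> R0; \<And>z. norm z \<le> R \<Longrightarrow> norm (h (f z)) \<le> A\<rbrakk>
       \<Longrightarrow> \<forall>w. norm w \<le> \<delta> * R\<^sup>2 \<longrightarrow> norm (h w) \<le> A"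
proof -
  obtain K :: real where K: "K \<ge> 1"
    "\<And>g R \<rho> z0. \<lbrakk>g holomorphic_on UNIV; R > 0; \<rho> > 0; norm (g 0) \<le> \<rho>; norm z0 \<le> R / 2;
        norm (g z0) > K * \<rho>\<rbrakk> \<Longrightarrow> \<exists>t\<ge>\<rho>. sphere 0 t \<subseteq> g ` cball (0::complex) R"
    using entire_image_contains_sphere by blast
  define c where "c = norm ((deriv ^^ k) f 0) / fact k"
  have c: "c > 0" using nz by (simp add: c_def)
  \<comment> \<open>If \<open>f\<close> stayed below \<open>K * \<delta> * R\<^sup>2\<close>,
    Cauchy's inequality would give \<open>c * (R / 2) ^ k \<le> c * R\<^sup>2 / 8\<close>, but the
    left side is at least \<open>c * R\<^sup>2 / 4\<close> once \<open>R \<ge> 2\<close>. The other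
    term of \<open>R0\<close> secures \<open>norm (f 0) \<le> \<delta> * R\<^sup>2\<close>.\<close>
  define \<delta> where "\<delta> = c / (8 * K)"
  define R0 where "R0 = max 2 (norm (f 0) / \<delta>)"
  have \<delta>: "\<delta> > 0" using c K(1) by (simp add: \<delta>_def)
  show thesis
  proof (rule that[of \<delta> R0])
    show "\<delta> > 0" by fact
    show "R0 > 0" by (simp add: R0_def)
    fix h R A
    assume h: "h holomorphic_on UNIV" and R: "R \<ge> R0"
      and A: "\<And>z. norm z \<le> R \<Longrightarrow> norm (h (f z)) \<le> A"
    have R2: "R \<ge> 2" "norm (f 0) / \<delta> \<le> R" using R by (auto simp: R0_def)
    have "norm (f 0) \<le> \<delta> * R" using R2(2) \<delta> by (simp add: divide_simps mult.commute)
    also have "\<dots> \<le> \<delta> * R\<^sup>2" using R2(1) \<delta> by (simp add: power2_eq_square)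
    finally have f0: "norm (f 0) \<le> \<delta> * R\<^sup>2" .
    have "\<exists>z0. norm z0 \<le> R / 2 \<and> norm (f z0) > K * (\<delta> * R\<^sup>2)"
    proof (rule ccontr)
      assume "\<not> ?thesis"
      then have "norm ((deriv ^^ k) f 0) \<le> fact k * (K * (\<delta> * R\<^sup>2)) / (R / 2) ^ k"
        using R2 by (intro entire_Cauchy_inequality f) (auto simp: not_less)
      then have "c * (R / 2) ^ k \<le> c / 8 * R\<^sup>2"
        using R2 K(1) by (simp add: c_def \<delta>_def field_simps)
      moreover have "(R / 2)\<^sup>2 \<le> (R / 2) ^ k"
        using R2 k by (intro power_increasing) auto
      ultimately have "c * (R / 2)\<^sup>2 \<le> c / 8 * R\<^sup>2"
        using c mult_left_mono[of "(R / 2)\<^sup>2" "(R / 2) ^ k" c] by linarith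
      then show False using c R2 by (simp add: power_divide)
    qed
    then obtain z0 where z0: "norm z0 \<le> R / 2" "norm (f z0) > K * (\<delta> * R\<^sup>2)"
      by blast
    obtain t where t: "t \<ge> \<delta> * R\<^sup>2" "sphere 0 t \<subseteq> f ` cball 0 R"
      using K(2)[OF f _ _ f0 z0] R2 \<delta> by auto
    show "\<forall>w. norm w \<le> \<delta> * R\<^sup>2 \<longrightarrow> norm (h w) \<le> A"
    proof (intro allI impI)
      fix w :: complex assume w: "norm w \<le> \<delta> * R\<^sup>2"
      show "norm (h w) \<le> A"
      proof (rule entire_bound_from_sphere[OF h])
        show "norm (h w') \<le> A" if "w' \<in> sphere 0 t" for w'
          using that t(2) A by fastforce
      qed (use w t in auto)
    qed
  qed
qed

section \<open>Iterates of non-affine maps\<close>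

lemma holomorphic_on_funpow_UNIV:
  "f holomorphic_on UNIV \<Longrightarrow> (f ^^ n) holomorphic_on UNIV"
  by (induction n) (auto simp: id_def[symmetric] intro: holomorphic_on_compose_gen)

text \<open>Written as \<open>R = x / \<delta>\<close>, the radius change from \<open>R\<close> to
  \<open>\<delta> * R\<^sup>2\<close> squares \<open>x\<close>, so \<open>n\<close> steps raise
  \<open>L\<close> to the power \<open>2 ^ n\<close>.\<close>

lemma non_affine_iterate_growth:
  assumes f: "f holomorphic_on UNIV" and k: "k \<ge> 2" and nz: "(deriv ^^ k) f 0 \<noteq> 0"
  obtains \<delta> L :: real where "\<delta> > 0" "L \<ge> 2" "L \<ge> \<delta>"
    "\<And>h n A. \<lbrakk>h holomorphic_on UNIV; \<And>z. norm z \<le> L / \<delta> \<Longrightarrow> norm (h ((f ^^ n) z)) \<le> A\<rbrakk>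
       \<Longrightarrow> \<forall>w. norm w \<le> L ^ (2 ^ n) / \<delta> \<longrightarrow> norm (h w) \<le> A"
proof -
  obtain \<delta> R0 :: real where \<delta>: "\<delta> > 0" and R0: "R0 > 0" and step:
    "\<And>h R A. \<lbrakk>h holomorphic_on UNIV; R \<ge> R0; \<And>z. norm z \<le> R \<Longrightarrow> norm (h (f z)) \<le> A\<rbrakk>
       \<Longrightarrow> \<forall>w. norm w \<le> \<delta> * R\<^sup>2 \<longrightarrow> norm (h w) \<le> A"
    using non_affine_growth[OF assms] by blast
  \<comment> \<open>The three terms make the powers of \<open>L\<close> grow, keep every radius at
    least 1, and put the first radius in the range of \<open>step\<close>.\<close>
  define L where "L = max 2 (max \<delta> (R0 * \<delta>))"
  have L: "L \<ge> 2" "L \<ge> \<delta>" "L \<ge> R0 * \<delta>" by (auto simp: L_def)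
  \<comment> \<open>The starting exponent \<open>m\<close> varies: one use of \<open>step\<close> on
    \<open>h \<circ> f ^^ n\<close> removes the innermost \<open>f\<close> and replaces
    \<open>m\<close> by \<open>Suc m\<close>.\<close>
  have *: "\<forall>w. norm w \<le> L ^ (2 ^ (m + n)) / \<delta> \<longrightarrow> norm (h w) \<le> A"
    if "h holomorphic_on UNIV"
      "\<And>z. norm z \<le> L ^ (2 ^ m) / \<delta> \<Longrightarrow> norm (h ((f ^^ n) z)) \<le> A" for h m n A
    using that
  proof (induction n arbitrary: m)
    case 0
    then show ?case by simp
  next
    case (Suc n)
    have "h \<circ> (f ^^ n) holomorphic_on UNIV"
      using holomorphic_on_compose_gen[OF holomorphic_on_funpow_UNIV[OF f] Suc.prems(1)] by simp
    moreover have "L ^ (2 ^ m) \<ge> L ^ 1"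
      using L by (intro power_increasing) auto
    then have "L ^ (2 ^ m) / \<delta> \<ge> R0"
      using L \<delta> by (simp add: divide_simps)
    ultimately have "\<forall>w. norm w \<le> \<delta> * (L ^ (2 ^ m) / \<delta>)\<^sup>2 \<longrightarrow> norm ((h \<circ> (f ^^ n)) w) \<le> A"
      by (rule step) (use Suc.prems(2) in \<open>simp add: funpow_swap1\<close>)
    moreover have "\<delta> * (L ^ (2 ^ m) / \<delta>)\<^sup>2 = L ^ (2 ^ Suc m) / \<delta>"
      using \<delta> by (simp add: power_divide power_mult[symmetric] power2_eq_square[of \<delta>] mult.commute)
    ultimately have "\<forall>w. norm w \<le> L ^ (2 ^ (Suc m + n)) / \<delta> \<longrightarrow> norm (h w) \<le> A"
      by (intro Suc.IH Suc.prems(1)) auto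
    then show ?case by simp
  qed
  show thesis
  proof
    show "\<forall>w. norm w \<le> L ^ (2 ^ n) / \<delta> \<longrightarrow> norm (h w) \<le> A"
      if "h holomorphic_on UNIV" "\<And>z. norm z \<le> L / \<delta> \<Longrightarrow> norm (h ((f ^^ n) z)) \<le> A" for h n A
      using *[of h 0 n A] that by simp
  qed (use \<delta> L in auto)
qed

lemma power_over_double_exponential_tendsto_zero:
  fixes C :: real
  assumes "C > 0"
  shows "(\<lambda>n. C ^ n / 2 ^ (2 ^ n)) \<longlonglongrightarrow> 0"
proof -
  have "(\<lambda>n. exp (ln C * real n - ln 2 * 2 powr real n)) \<longlonglongrightarrow> 0"
    by real_asymp
  moreover have "C ^ n = exp (ln C * real n)" "2 ^ (2 ^ n) = exp (ln 2 * 2 powr real n)" for n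
    using assms exp_of_nat2_mult[of "ln 2 :: real" "2 ^ n"]
    by (auto simp: powr_realpow exp_of_nat2_mult)
  ultimately show ?thesis by (simp add: exp_diff)
qed

text \<open>Otherwise Cauchy's inequality on the doubly exponentially growing discs bounds each
  derivative of \<open>h\<close> at 0 of positive order by a null sequence, although one of them is
  nonzero.\<close>

lemma affine_if_iterates_exponentially_bounded:
  assumes f: "f holomorphic_on UNIV" and h: "h holomorphic_on UNIV" "\<not> h constant_on UNIV"
    and C: "C > 0"
    and bound: "\<And>K. compact K \<Longrightarrow> \<exists>A. \<forall>n. \<forall>z\<in>K. norm (h ((f ^^ n) z)) \<le> A * C ^ n"
  shows "\<exists>a b. \<forall>z. f z = a * z + b"
proof (cases "\<exists>k\<ge>2. (deriv ^^ k) f 0 \<noteq> 0")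
  case False
  then have eq: "f z = (\<Sum>k\<le>1. (deriv ^^ k) f 0 / fact k * (z - 0) ^ k)" for z
    by (intro entire_polynomial_if_higher_derivs_zero f) auto
  have "f z = deriv f 0 * z + f 0" for z
    by (subst eq) simp
  then show ?thesis by blast
next
  case True
  then obtain \<delta> L :: real where \<delta>: "\<delta> > 0" and L: "L \<ge> 2" "L \<ge> \<delta>" and growth:
    "\<And>h n A. \<lbrakk>h holomorphic_on UNIV; \<And>z. norm z \<le> L / \<delta> \<Longrightarrow> norm (h ((f ^^ n) z)) \<le> A\<rbrakk>
       \<Longrightarrow> \<forall>w. norm w \<le> L ^ (2 ^ n) / \<delta> \<longrightarrow> norm (h w) \<le> A"
    using non_affine_iterate_growth[OF f] by blast
  obtain A where A: "\<And>n z. norm z \<le> L / \<delta> \<Longrightarrow> norm (h ((f ^^ n) z)) \<le> A * C ^ n"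
    using bound[OF compact_cball, of 0 "L / \<delta>"]
    unfolding mem_cball_0[symmetric] by blast
  obtain k where k: "k > 0" "(deriv ^^ k) h 0 \<noteq> 0"
  proof (rule ccontr)
    assume "\<not> thesis"
    then have eq: "h z = (\<Sum>k\<le>0. (deriv ^^ k) h 0 / fact k * (z - 0) ^ k)" for z
      by (intro entire_polynomial_if_higher_derivs_zero h) (use that in auto)
    have "h z = h 0" for z
      by (subst eq) simp
    then have "h constant_on UNIV" unfolding constant_on_def by blast
    with h(2) show False by simp
  qed
  have A0: "A \<ge> 0"
    using A[of 0 0] \<delta> L norm_ge_zero[of "h 0"] by (simp del: norm_ge_zero)
  have le: "norm ((deriv ^^ k) h 0) \<le> fact k * A * \<delta> * (C ^ n / 2 ^ (2 ^ n))" for n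
  proof -
    define r where "r = L ^ (2 ^ n) / \<delta>"
    have "L ^ 1 \<le> L ^ (2 ^ n)"
      using L by (intro power_increasing) auto
    then have r1: "r \<ge> 1"
      using \<delta> L by (simp add: r_def divide_simps)
    have r2: "r \<ge> 2 ^ (2 ^ n) / \<delta>"
      using L \<delta> by (auto simp: r_def intro!: divide_right_mono power_mono)
    have "norm ((deriv ^^ k) h 0) \<le> fact k * (A * C ^ n) / r ^ k"
      using growth[OF h(1) A] r1 by (intro entire_Cauchy_inequality h) (auto simp: r_def)
    \<comment> \<open>As \<open>r \<ge> 1\<close> and \<open>k \<ge> 1\<close>, one factor
      \<open>r\<close> suffices against \<open>C ^ n\<close>.\<close>
    also have "\<dots> \<le> fact k * (A * C ^ n) / r"
      using r1 k A0 C power_increasing[of 1 k r] by (intro divide_left_mono) auto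
    also have "\<dots> \<le> fact k * (A * C ^ n) / (2 ^ (2 ^ n) / \<delta>)"
      using r2 r1 A0 C \<delta> by (intro divide_left_mono) auto
    finally show ?thesis by (simp add: mult_ac)
  qed
  have "(\<lambda>n. C ^ n / 2 ^ (2 ^ n)) \<longlonglongrightarrow> 0"
    using C by (rule power_over_double_exponential_tendsto_zero)
  then have "(\<lambda>n. fact k * A * \<delta> * (C ^ n / 2 ^ (2 ^ n))) \<longlonglongrightarrow> fact k * A * \<delta> * 0"
    by (intro tendsto_intros)
  then have "norm ((deriv ^^ k) h 0) \<le> fact k * A * \<delta> * 0"
    by (rule LIMSEQ_le_const) (use le in auto)
  with k(2) show ?thesis by simp
qed

section \<open>Expanding affine maps and spaces of polynomials\<close>

text \<open>The point \<open>b / (1 - a)\<close> is fixed, and \<open>f ^^ n\<close> maps the unit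
  disc around it onto the disc of radius \<open>norm a ^ n\<close>. Cauchy's inequality there bounds
  the derivative by a multiple of \<open>(C / norm a ^ k) ^ n\<close>, which tends to 0.\<close>

lemma expanding_affine_bound_imp_derivs_zero:
  fixes a b :: complex
  assumes h: "h holomorphic_on UNIV" and f: "\<And>z. f z = a * z + b" and a: "norm a > 1"
    and C: "C > 0"
    and bound: "\<And>K. compact K \<Longrightarrow> \<exists>A. \<forall>n. \<forall>z\<in>K. norm (h ((f ^^ n) z)) \<le> A * C ^ n"
    and k: "C < norm a ^ k"
  shows "(deriv ^^ k) h (b / (1 - a)) = 0"
proof -
  define p where "p = b / (1 - a)"
  have "a \<noteq> 1" using a by auto
  then have p: "a * p + b = p" by (simp add: p_def field_simps)
  have iter: "(f ^^ n) z = p + a ^ n * (z - p)" for n z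
  proof (induction n)
    case (Suc n)
    have "(f ^^ Suc n) z = a * (p + a ^ n * (z - p)) + b"
      by (simp only: funpow.simps comp_apply Suc f)
    also have "\<dots> = (a * p + b) + a ^ Suc n * (z - p)"
      by (simp add: algebra_simps)
    finally show ?case by (simp only: p)
  qed simp
  obtain A where A: "\<And>n z. z \<in> cball p 1 \<Longrightarrow> norm (h ((f ^^ n) z)) \<le> A * C ^ n"
    using bound[OF compact_cball, of p 1] by blast
  have "norm ((deriv ^^ k) h p) \<le> fact k * A * (C / norm a ^ k) ^ n" for n
  proof -
    have "norm (h w) \<le> A * C ^ n" if "w \<in> cball p (norm a ^ n)" for w
    proof -
      have "a \<noteq> 0" "a ^ n \<noteq> 0" using a by auto
      then have "w = (f ^^ n) (p + (w - p) / a ^ n)"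
        by (simp add: iter)
      moreover have "p + (w - p) / a ^ n \<in> cball p 1"
        using that \<open>a \<noteq> 0\<close>
        by (simp add: dist_norm norm_divide norm_power norm_minus_commute divide_simps)
      ultimately show ?thesis using A by metis
    qed
    then have "norm ((deriv ^^ k) h p) \<le> fact k * (A * C ^ n) / (norm a ^ n) ^ k"
      using \<open>norm a > 1\<close> by (intro entire_Cauchy_inequality h zero_less_power) auto
    then show ?thesis by (simp add: power_divide mult_ac flip: power_mult)
  qed
  moreover have "(\<lambda>n. fact k * A * (C / norm a ^ k) ^ n) \<longlonglongrightarrow> fact k * A * 0"
    using C k a by (intro tendsto_intros LIMSEQ_realpow_zero) (auto simp: divide_simps)
  ultimately have "norm ((deriv ^^ k) h p) \<le> fact k * A * 0"
    by (intro LIMSEQ_le_const) auto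
  then show ?thesis by (simp add: p_def)
qed

lemma sum_fun_apply: "(\<Sum>k\<in>A. F k) x = (\<Sum>k\<in>A. F k x)"
  by (induction A rule: infinite_finite_induct) (auto simp: zero_fun_def)

lemma finite_dimensional_if_bounded_degree:
  assumes V: "cfun.subspace V" "V \<subseteq> entire_functions"
    and z: "\<And>h k. h \<in> V \<Longrightarrow> k > N \<Longrightarrow> (deriv ^^ k) h p = 0"
  shows "\<not> infinite_dimensional V"
proof -
  define M where "M = (\<lambda>k z. (z - p) ^ k) ` {..N}"
  have "h \<in> cfun.span M" if "h \<in> V" for h
  proof -
    have "h z = (\<Sum>k\<le>N. (deriv ^^ k) h p / fact k * (z - p) ^ k)" for z
      using that V z by (intro entire_polynomial_if_higher_derivs_zero) (auto simp: entire_functions_def)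
    then have "h = (\<Sum>k\<le>N. cscale ((deriv ^^ k) h p / fact k) (\<lambda>z. (z - p) ^ k))"
      by (simp add: fun_eq_iff cscale_def sum_fun_apply)
    moreover have "\<dots> \<in> cfun.span M"
      by (intro cfun.span_sum cfun.span_scale cfun.span_base) (auto simp: M_def)
    ultimately show ?thesis by simp
  qed
  then have VM: "V \<subseteq> cfun.span M" by blast
  \<comment> \<open>The monomials in \<open>M\<close> may lie outside \<open>V\<close>, so a basis
    is chosen inside \<open>V\<close>; independence within the span of the finite set
    \<open>M\<close> makes it finite.\<close>
  obtain B where B: "B \<subseteq> V" "cfun.independent B" "V \<subseteq> cfun.span B"
    using cfun.maximal_independent_subset by blast
  have "finite B"
    using cfun.independent_span_bound[of M B] B VM by (auto simp: M_def)
  moreover have "cfun.span B = V"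
    using B V(1) cfun.span_minimal by blast
  ultimately show ?thesis
    using B by (auto simp: infinite_dimensional_def)
qed

section \<open>Iterated composition operators\<close>

lemma openin_entire_topology_bounded_on_compact:
  assumes "compact K"
  shows "openin entire_topology {h \<in> entire_functions. \<forall>z\<in>K. norm (h z) < 1}"
  unfolding openin_entire_topology
proof (intro conjI ballI)
  fix g assume "g \<in> {h \<in> entire_functions. \<forall>z\<in>K. norm (h z) < 1}"
  then have g: "g holomorphic_on UNIV" and lt: "\<And>z. z \<in> K \<Longrightarrow> norm (g z) < 1"
    by (auto simp: entire_functions_def)
  \<comment> \<open>\<open>norm (g z)\<close> attains its maximum on the compact set
    \<open>K\<close>, which leaves a uniform gap below 1.\<close>
  have "\<exists>e>0. \<forall>z\<in>K. norm (g z) \<le> 1 - e"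
  proof (cases "K = {}")
    case False
    have "continuous_on K (\<lambda>z. norm (g z))"
      using g holomorphic_on_imp_continuous_on continuous_on_subset by (blast intro: continuous_on_norm)
    then obtain x where "x \<in> K" "\<And>z. z \<in> K \<Longrightarrow> norm (g z) \<le> norm (g x)"
      using continuous_attains_sup[OF assms False] by blast
    then show ?thesis
      using lt by (intro exI[of _ "1 - norm (g x)"]) auto
  qed (auto intro: exI[of _ 1])
  then obtain e where e: "e > 0" "\<And>z. z \<in> K \<Longrightarrow> norm (g z) \<le> 1 - e" by blast
  have "norm (h z) < 1" if "\<forall>z\<in>K. dist (h z) (g z) < e" "z \<in> K" for h z
    using that e(2)[of z] norm_triangle_sub[of "h z" "g z"] by (fastforce simp: dist_norm)
  then show "\<exists>K' e. compact K' \<and> e > 0 \<and> {h \<in> entire_functions. \<forall>z\<in>K'. dist (h z) (g z) < e}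
      \<subseteq> {h \<in> entire_functions. \<forall>z\<in>K. norm (h z) < 1}"
    using assms e(1) by (intro exI[of _ K] exI[of _ e]) auto
qed auto

text \<open>By continuity of scalar multiplication at the scalar 0, a small nonzero multiple of
  \<open>h\<close> lies in \<open>U\<close>.\<close>

lemma complex_tvs_zero_neighbourhood_absorbing:
  assumes tvs: "complex_tvs V T" and U: "openin T U" "0 \<in> U" and h: "h \<in> V"
  obtains c u where "c \<noteq> 0" "u \<in> U" "h = cscale c u"
proof -
  have top: "topspace T = V" and
    sc: "continuous_map (prod_topology euclidean T) T (\<lambda>(c, h). cscale c h)"
    using tvs by (auto simp: complex_tvs_def)
  have "continuous_map euclidean T (\<lambda>c. cscale c h)"
    using continuous_map_compose[OF _ sc, of euclidean "\<lambda>c. (c, h)"] h top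
    by (auto simp: comp_def continuous_map_pairwise)
  then have "open {c. cscale c h \<in> U}"
    using U(1) by (auto simp: continuous_map_def simp flip: open_openin)
  moreover have "cscale 0 h \<in> U"
    using U(2) by (simp add: cfun.scale_zero_left)
  ultimately obtain e where e: "e > 0" "ball 0 e \<subseteq> {c. cscale c h \<in> U}"
    unfolding open_contains_ball by blast
  define c :: complex where "c = of_real (e / 2)"
  have "c \<noteq> 0" "c \<in> ball 0 e" using e(1) by (auto simp: c_def)
  then have "inverse c \<noteq> 0" "cscale c h \<in> U" "h = cscale (inverse c) (cscale c h)"
    using e(2) by auto
  then show thesis using that by blast
qed

lemma tvs_boundedE:
  assumes "tvs_bounded T B" "openin T U" "0 \<in> U"
  obtains s :: real where "s > 0" "\<And>h. h \<in> B \<Longrightarrow> \<exists>u\<in>U. h = cscale (of_real s) u"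
proof -
  obtain s where s: "s > 0" "\<And>c. norm c \<ge> s \<Longrightarrow> B \<subseteq> cscale c ` U"
    using assms unfolding tvs_bounded_def by blast
  then have "B \<subseteq> cscale (of_real s) ` U" by simp
  then show thesis using that s(1) by blast
qed

section \<open>Exponential bounds along orbits, and the conclusion\<close>

lemma iterates_exponentially_bounded:
  assumes qb: "quasi_banach_space V T"
    and incl: "continuous_map T entire_topology (\<lambda>h. h)"
    and comp: "induces_bounded_composition_operator f V T"
  obtains C :: real where "C > 0"
    "\<And>h K. h \<in> V \<Longrightarrow> compact K \<Longrightarrow> \<exists>A. \<forall>n. \<forall>z\<in>K. norm (h ((f ^^ n) z)) \<le> A * C ^ n"
proof -
  obtain B where tvs: "complex_tvs V T" and B: "tvs_bounded T B" "0 \<in> T interior_of B"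
    using qb by (auto simp: quasi_banach_space_def)
  have top: "topspace T = V" using tvs by (auto simp: complex_tvs_def)
  \<comment> \<open>The interior of \<open>B\<close> makes \<open>W\<close> open, so boundedness
    gives \<open>B \<subseteq> C W\<close>; composing with \<open>f\<close> sends \<open>W\<close>
    into \<open>B\<close>. Thus \<open>C\<close> is fixed before \<open>h\<close> and
    \<open>K\<close> are chosen.\<close>
  define W where "W = {h \<in> V. composition_operator f h \<in> T interior_of B}"
  have "openin T W"
    using comp top openin_interior_of[of T B]
    by (auto simp: W_def induces_bounded_composition_operator_def continuous_map_def)
  moreover have "0 \<in> W"
    using B(2) interior_of_subset_topspace[of T B] top
    by (auto simp: W_def composition_operator_def comp_def zero_fun_def)
  ultimately obtain C :: real where C: "C > 0" "\<And>h. h \<in> B \<Longrightarrow> \<exists>w\<in>W. h = cscale (of_real C) w"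
    using tvs_boundedE[OF B(1)] by blast
  have step: "\<exists>w\<in>B. \<forall>z. h (f z) = of_real C * w z" if "h \<in> B" for h
  proof -
    obtain w where w: "w \<in> W" "h = cscale (of_real C) w" using C(2)[OF \<open>h \<in> B\<close>] by blast
    then have "w \<circ> f \<in> B"
      using interior_of_subset by (fastforce simp: W_def composition_operator_def)
    then show ?thesis using w(2) by (intro bexI[of _ "w \<circ> f"]) (auto simp: cscale_def)
  qed
  have iter: "\<exists>w\<in>B. \<forall>z. h ((f ^^ n) z) = of_real C ^ n * w z" if "h \<in> B" for h n
  proof (induction n)
    case 0
    then show ?case using that by auto
  next
    case (Suc n)
    then obtain w where w: "w \<in> B" "\<And>z. h ((f ^^ n) z) = of_real C ^ n * w z" by blast
    obtain w' where "w' \<in> B" "\<And>z. w (f z) = of_real C * w' z" using step[OF w(1)] by blast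
    then show ?case
      using w(2) by (intro bexI[of _ w']) (auto simp: funpow_swap1)
  qed
  show thesis
  proof
    show "C > 0" by fact
    fix h and K :: "complex set" assume h: "h \<in> V" and K: "compact K"
    obtain c u where u: "u \<in> B" "h = cscale c u"
      using complex_tvs_zero_neighbourhood_absorbing[OF tvs openin_interior_of B(2) h]
        interior_of_subset by (metis subsetD)
    \<comment> \<open>This neighbourhood of 0 absorbs \<open>B\<close>, so all elements of
      \<open>B\<close> share the bound \<open>t\<close> on \<open>K\<close>.\<close>
    let ?N = "{g \<in> V. g \<in> entire_functions \<and> (\<forall>z\<in>K. norm (g z) < 1)}"
    have "openin T ?N"
      using incl openin_entire_topology_bounded_on_compact[OF K] top
      by (auto simp: continuous_map_def)
    moreover have "0 \<in> ?N"
      using B(2) interior_of_subset_topspace[of T B] top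
      by (auto simp: entire_functions_def zero_fun_def)
    ultimately obtain t :: real where t: "t > 0" "\<And>g. g \<in> B \<Longrightarrow> \<exists>v\<in>?N. g = cscale (of_real t) v"
      using tvs_boundedE[OF B(1)] by blast
    have Bt: "norm (g z) \<le> t" if "g \<in> B" "z \<in> K" for g z
    proof -
      obtain v where "v \<in> ?N" "g = cscale (of_real t) v" using t(2)[OF \<open>g \<in> B\<close>] by blast
      then show ?thesis using that(2) t(1) by (auto simp: cscale_def norm_mult less_imp_le)
    qed
    have "norm (h ((f ^^ n) z)) \<le> norm c * t * C ^ n" if z: "z \<in> K" for n z
    proof -
      obtain w where w: "w \<in> B" "\<And>z. u ((f ^^ n) z) = of_real C ^ n * w z"
        using iter[OF u(1)] by blast
      have "norm (h ((f ^^ n) z)) = norm c * (C ^ n * norm (w z))"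
        using C(1) by (simp add: u(2) cscale_def w(2) norm_mult norm_power)
      also have "\<dots> \<le> norm c * (C ^ n * t)"
        using Bt[OF w(1) z] C(1) by (intro mult_left_mono) auto
      finally show ?thesis by (simp add: mult_ac)
    qed
    then show "\<exists>A. \<forall>n. \<forall>z\<in>K. norm (h ((f ^^ n) z)) \<le> A * C ^ n" by blast
  qed
qed

theorem theorem1p2:
  fixes V :: "(complex \<Rightarrow> complex) set"
    and T :: "(complex \<Rightarrow> complex) topology"
    and f :: "complex \<Rightarrow> complex"
  assumes "quasi_banach_space V T"
    and "V \<subseteq> entire_functions"
    and "continuous_map T entire_topology (\<lambda>h. h)"
    and "\<exists>h\<in>V. \<not> h constant_on UNIV"
    and "f holomorphic_on UNIV"
    and "induces_bounded_composition_operator f V T"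
  shows "\<exists>a b. (\<forall>z. f z = a * z + b) \<and> (infinite_dimensional V \<longrightarrow> norm a \<le> 1)"
proof -
  obtain C :: real where C: "C > 0" and bound:
    "\<And>h K. h \<in> V \<Longrightarrow> compact K \<Longrightarrow> \<exists>A. \<forall>n. \<forall>z\<in>K. norm (h ((f ^^ n) z)) \<le> A * C ^ n"
    using iterates_exponentially_bounded[OF assms(1,3,6)] by blast
  have hol: "h holomorphic_on UNIV" if "h \<in> V" for h
    using that assms(2) by (auto simp: entire_functions_def)
  obtain h where h: "h \<in> V" "\<not> h constant_on UNIV" using assms(4) by blast
  obtain a b where ab: "\<And>z. f z = a * z + b"
    using affine_if_iterates_exponentially_bounded[OF assms(5) hol[OF h(1)] h(2) C bound[OF h(1)]]
    by blast
  have "\<not> infinite_dimensional V" if a: "norm a > 1"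
  proof -
    \<comment> \<open>Since \<open>C\<close> does not depend on \<open>h\<close>, one degree bound
      \<open>N\<close> serves all of \<open>V\<close>.\<close>
    obtain N where N: "C < norm a ^ N" using real_arch_pow[OF a] by blast
    have "C < norm a ^ k" if "k > N" for k
      using N power_increasing[of N k "norm a"] that a by linarith
    then have "(deriv ^^ k) h (b / (1 - a)) = 0" if "h \<in> V" "k > N" for h k
      using that by (intro expanding_affine_bound_imp_derivs_zero[OF hol[OF \<open>h \<in> V\<close>] ab a C bound[OF \<open>h \<in> V\<close>]]) auto
    moreover have "cfun.subspace V"
      using assms(1) by (simp add: quasi_banach_space_def complex_tvs_def)
    ultimately show ?thesis
      using assms(2) finite_dimensional_if_bounded_degree by blast
  qed
  then show ?thesis using ab by (meson not_le)
qed

end
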